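(* Let $V$ be a Hilbert space over $\mathbb{K}=\mathbb{R}$ or $\mathbb{C}$, let $A_0$ be a densely defined skew-symmetric operator on $V$, let $A:=-A_0^*$, and let $(H_-,H_+,G_-,G_+)$ be a boundary quadruple for $A_0$. Equip $D(A)$ with the graph norm $\|u\|_{D(A)}^2:=\|u\|_V^2+\|Au\|_V^2$. Then the operators $G_-:D(A)\to H_-$ and $G_+:D(A)\to H_+$ are continuous.
   Context: Inner products are linear in the first argument (and conjugate-linear in the second if $\mathbb{K}=\mathbb{C}$). An operator on $V$ is a linear map defined on a linear subspace (its domain) of $V$ with values in $V$. $A_0$ is skew-symmetric if $\langle A_0u,v\rangle_V+\langle u,A_0v\rangle_V=0$ for all $u,v\in D(A_0)$. With $A:=-A_0^*$, $D(A)=D(A_0^* )$, one has $A_0\subset A$. A boundary quadruple $(H_-,H_+,G_-,G_+)$ for $A_0$ consists of pre-Hilbert spaces $H_-,H_+$ over $\mathbb{K}$ (completeness is not assumed) and surjective linear maps $G_-:D(A)\to H_-$, $G_+:D(A)\to H_+$ (continuity is not assumed) such that $\langle Au,v\rangle_V+\langle u,Av\rangle_V=\langle G_+u,G_+v\rangle_{H_+}-\langle G_-u,G_-v\rangle_{H_-}$ for all $u,v\in D(A)$, and $\ker G_-+\ker G_+=D(A)$. *)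

theory Defs
  imports "HOL-Analysis.Analysis"
begin

text \<open>
  The scalar fields: up to isometric isomorphism, \<open>rc_field\<close> has exactly the two
  models \<open>real\<close> and \<open>complex\<close>, each with its usual norm and conjugation
  (instances and lemma \<open>rc_field_real_or_complex\<close> below).
\<close>

class rc_field = real_normed_field +
  fixes kcnj :: "'a \<Rightarrow> 'a"
  assumes kcnj_add: "kcnj (x + y) = kcnj x + kcnj y"
    and kcnj_mult: "kcnj (x * y) = kcnj x * kcnj y"
    and kcnj_kcnj: "kcnj (kcnj x) = x"
    and mult_kcnj_scaleR: "x * kcnj x = (norm x)\<^sup>2 *\<^sub>R 1"

lemma mult_kcnj: "x * kcnj x = of_real ((norm (x :: 'k::rc_field))\<^sup>2)"
  by (simp add: mult_kcnj_scaleR of_real_def)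

instantiation real :: rc_field
begin
definition kcnj_real :: "real \<Rightarrow> real" where "kcnj_real x = x"
instance by standard (simp_all add: kcnj_real_def power2_eq_square)
end

instantiation complex :: rc_field
begin
definition kcnj_complex :: "complex \<Rightarrow> complex" where "kcnj_complex = cnj"
instance by standard (simp_all add: kcnj_complex_def complex_norm_square[symmetric] scaleR_conv_of_real)
end

lemma kcnj_0 [simp]: "kcnj (0::'k::rc_field) = 0"
  using kcnj_add[of "0::'k" 0] by simp

lemma kcnj_of_real [simp]: "kcnj (of_real r :: 'k::rc_field) = of_real r"
proof (cases "r = 0")
  case False
  have "of_real r * kcnj (of_real r :: 'k) = of_real r * of_real r"
    by (simp add: mult_kcnj power2_eq_square)
  then show ?thesis using False by simp
qed simp

lemma kcnj_minus: "kcnj (- x :: 'k::rc_field) = - kcnj x"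
  using kcnj_add[of x "- x"] by (simp add: eq_neg_iff_add_eq_0 add.commute)

lemma norm_kcnj [simp]: "norm (kcnj x :: 'k::rc_field) = norm x"
proof -
  have "of_real ((norm (kcnj x))\<^sup>2) = (of_real ((norm x)\<^sup>2) :: 'k)"
    using mult_kcnj[of x] mult_kcnj[of "kcnj x"] by (simp add: kcnj_kcnj mult.commute)
  then show ?thesis by (simp only: of_real_eq_iff power2_eq_iff_nonneg norm_ge_zero)
qed

lemma add_kcnj: "(x :: 'k::rc_field) + kcnj x = of_real ((norm (1 + x))\<^sup>2 - 1 - (norm x)\<^sup>2)"
proof -
  have "(1 + x) * kcnj (1 + x) = 1 + x + kcnj x + x * kcnj x"
    using kcnj_of_real[of 1, where 'k='k] by (simp add: kcnj_add algebra_simps)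
  then show ?thesis by (simp add: mult_kcnj algebra_simps)
qed

lemma self_conj_real: "kcnj (x :: 'k::rc_field) = x \<Longrightarrow> \<exists>r. x = of_real r"
proof -
  assume "kcnj x = x"
  then have "2 * x = of_real ((norm (1 + x))\<^sup>2 - 1 - (norm x)\<^sup>2)"
    using add_kcnj[of x] by simp
  then have "x = of_real (((norm (1 + x))\<^sup>2 - 1 - (norm x)\<^sup>2) / 2)"
    by (simp add: field_simps)
  then show ?thesis by blast
qed

lemma rc_field_real_or_complex:
  "bij (of_real :: real \<Rightarrow> 'k) \<or>
   (\<exists>f :: complex \<Rightarrow> 'k::rc_field. bij f \<and>
      (\<forall>z w. f (z + w) = f z + f w) \<and> (\<forall>z w. f (z * w) = f z * f w) \<and>
      (\<forall>r. f (of_real r) = of_real r) \<and>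
      (\<forall>z. norm (f z) = norm z) \<and> (\<forall>z. f (cnj z) = kcnj (f z)))"
proof (cases "\<forall>x::'k. kcnj x = x")
  case True
  then have "surj (of_real :: real \<Rightarrow> 'k)" using self_conj_real by (metis surjI surj_def)
  then show ?thesis by (simp add: bij_def inj_of_real)
next
  case False
  then obtain x :: 'k where x: "kcnj x \<noteq> x" by blast
  define y where "y = x - kcnj x"
  have y0: "y \<noteq> 0" using x by (simp add: y_def)
  have cy: "kcnj y = - y"
    using kcnj_add[of x "- kcnj x"] by (simp add: y_def kcnj_minus kcnj_kcnj)
  define j where "j = y / of_real (norm y)"
  have yj: "y = of_real (norm y) * j" using y0 by (simp add: j_def)
  have "of_real (norm y) * kcnj j = of_real (norm y) * (- j)"
    using cy kcnj_mult[of "of_real (norm y)" j] yj by simp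
  then have cj: "kcnj j = - j" using y0 by (metis mult_left_cancel norm_eq_zero of_real_eq_0_iff)
  have nj: "norm j = 1" using y0 by (simp add: j_def norm_divide)
  have jj: "j * j = - 1" using mult_kcnj[of j] cj nj
    by (metis minus_equation_iff mult_minus_right of_real_1 power_one)
  define f where "f = (\<lambda>z. of_real (Re z) + of_real (Im z) * j)"
  have add: "f (z + w) = f z + f w" for z w by (simp add: f_def algebra_simps)
  have mult: "f (z * w) = f z * f w" for z w
  proof -
    have "f z * f w = of_real (Re z * Re w) + of_real (Im z * Im w) * (j * j)
            + of_real (Re z * Im w + Im z * Re w) * j"
      by (simp add: f_def algebra_simps)
    then show ?thesis by (simp add: jj f_def algebra_simps)
  qed
  have re: "f (of_real r) = of_real r" for r by (simp add: f_def)
  have cn: "f (cnj z) = kcnj (f z)" for z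
    by (simp add: f_def kcnj_add kcnj_mult cj)
  have nm: "norm (f z) = norm z" for z
  proof -
    have "of_real ((norm (f z))\<^sup>2) = (of_real ((norm z)\<^sup>2) :: 'k)"
      using mult_kcnj[of "f z"] mult[of z "cnj z"] cn[of z] re[of "(norm z)\<^sup>2"]
        complex_norm_square[of z] by simp
    then show ?thesis by (simp only: of_real_eq_iff power2_eq_iff_nonneg norm_ge_zero)
  qed
  have "inj f"
  proof (rule injI)
    fix z w assume e: "f z = f w"
    have "f z = f (z - w) + f w" using add[of "z - w" w] by simp
    with e have "f (z - w) = 0" by simp
    then show "z = w" using nm[of "z - w"] by simp
  qed
  moreover have "\<exists>z. x = f z" for x
  proof -
    have "kcnj (x + kcnj x) = x + kcnj x" by (simp add: kcnj_add kcnj_kcnj add.commute)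
    then obtain a where a: "x + kcnj x = of_real a" using self_conj_real by blast
    have "kcnj (x - kcnj x) = kcnj x - x"
      using kcnj_add[of x "- kcnj x"] by (simp add: kcnj_minus kcnj_kcnj)
    then have "kcnj ((x - kcnj x) * j) = (x - kcnj x) * j"
      by (simp only: kcnj_mult cj) (simp add: algebra_simps)
    then obtain b where b: "(x - kcnj x) * j = of_real b" using self_conj_real by blast
    have "(x - kcnj x) * (j * j) = of_real b * j" using b by (simp add: mult.assoc[symmetric])
    then have "x - kcnj x = - of_real b * j" by (simp add: jj algebra_simps)
    then have "(x + kcnj x) + (x - kcnj x) = of_real a - of_real b * j" by (simp add: a)
    then have "2 * x = of_real a - of_real b * j" by simp
    then have "x = f (Complex (a / 2) (- b / 2))"
      by (simp add: f_def field_simps)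
    then show ?thesis by blast
  qed
  then have "surj f" by (auto simp: surj_def)
  ultimately show ?thesis using add mult re cn nm unfolding bij_def by blast
qed

locale pre_hilbert_space = vector_space scale
  for scale :: "'k::rc_field \<Rightarrow> 'v::ab_group_add \<Rightarrow> 'v" +
  fixes ip :: "'v \<Rightarrow> 'v \<Rightarrow> 'k"
  assumes ip_add_left: "ip (u + v) w = ip u w + ip v w"
    and ip_scale_left: "ip (scale c u) v = c * ip u v"
    and ip_conj_sym: "ip v u = kcnj (ip u v)"
    and ip_nonneg: "\<exists>r\<ge>0. ip u u = of_real r"
    and ip_definite: "ip u u = 0 \<Longrightarrow> u = 0"

text \<open>As \<open>ip u u\<close> is a nonnegative real, \<open>norm (ip u u)\<close> is just its value in \<open>real\<close>.\<close>

definition ip_norm :: "('v \<Rightarrow> 'v \<Rightarrow> 'k::rc_field) \<Rightarrow> 'v \<Rightarrow> real"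
  where "ip_norm ip u = sqrt (norm (ip u u))"

definition ip_dist :: "('v::ab_group_add \<Rightarrow> 'v \<Rightarrow> 'k::rc_field) \<Rightarrow> 'v \<Rightarrow> 'v \<Rightarrow> real"
  where "ip_dist ip u v = ip_norm ip (u - v)"

context pre_hilbert_space
begin

lemma ip_self: "ip u u = of_real ((ip_norm ip u)\<^sup>2)"
  using ip_nonneg[of u] by (auto simp: ip_norm_def)

lemma ip_add_right: "ip w (u + v) = ip w u + ip w v"
  by (metis ip_add_left ip_conj_sym kcnj_add)

lemma ip_scale_right: "ip u (scale c v) = kcnj c * ip u v"
  by (metis ip_scale_left ip_conj_sym kcnj_mult)

lemma ip_norm_scale: "ip_norm ip (scale c u) = norm c * ip_norm ip u"
  by (simp add: ip_norm_def ip_scale_left ip_scale_right norm_mult real_sqrt_mult)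

lemma ip_norm_ge0: "0 \<le> ip_norm ip u"
  by (simp add: ip_norm_def)

lemma ip_norm_eq_0: "ip_norm ip u = 0 \<longleftrightarrow> u = 0"
  using ip_definite[of u] ip_scale_left[of 0 0 0] by (auto simp: ip_norm_def)

lemma ip_norm_add_sq:
  "of_real ((ip_norm ip (u + v))\<^sup>2)
     = of_real ((ip_norm ip u)\<^sup>2 + (ip_norm ip v)\<^sup>2) + (ip u v + kcnj (ip u v))"
  unfolding of_real_add ip_self[symmetric] ip_conj_sym[of v u, symmetric]
  by (simp add: ip_add_left ip_add_right)

lemma Cauchy_Schwarz: "norm (ip u v) \<le> ip_norm ip u * ip_norm ip v"
proof (cases "v = 0")
  case True
  then show ?thesis using ip_scale_right[of u 0 0] by (simp add: ip_norm_def)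
next
  case False
  define n where "n = (ip_norm ip v)\<^sup>2"
  have n: "n > 0" using False ip_norm_ge0[of v] ip_norm_eq_0[of v] by (simp add: n_def)
  define c where "c = - ip u v / of_real n"
  have kc: "kcnj c * of_real n = - kcnj (ip u v)"
    using n kcnj_mult[of c "of_real n"] by (simp add: c_def kcnj_minus[symmetric])
  have "ip u (scale c v) = - (ip u v * kcnj (ip u v)) / of_real n"
  proof -
    have "ip u (scale c v) * of_real n = (kcnj c * of_real n) * ip u v"
      by (simp add: ip_scale_right ac_simps)
    then show ?thesis using n unfolding kc by (simp add: field_simps)
  qed
  then have e: "ip u (scale c v) = of_real (- ((norm (ip u v))\<^sup>2 / n))"
    by (simp add: mult_kcnj)
  have m: "(ip_norm ip (scale c v))\<^sup>2 = (norm (ip u v))\<^sup>2 / n"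
    unfolding ip_norm_scale power_mult_distrib n_def[symmetric]
    using n by (simp add: c_def norm_divide power2_eq_square)
  have "of_real ((ip_norm ip (u + scale c v))\<^sup>2)
      = (of_real ((ip_norm ip u)\<^sup>2 - (norm (ip u v))\<^sup>2 / n) :: 'k)"
    unfolding ip_norm_add_sq m e kcnj_of_real of_real_add[symmetric] by simp
  then have "(ip_norm ip u)\<^sup>2 - (norm (ip u v))\<^sup>2 / n \<ge> 0"
    by (metis of_real_eq_iff zero_le_power2)
  then have "(norm (ip u v))\<^sup>2 \<le> (ip_norm ip u * ip_norm ip v)\<^sup>2"
    using n by (simp add: field_simps power_mult_distrib n_def[symmetric])
  then show ?thesis
    by (rule power2_le_imp_le) (simp add: ip_norm_ge0)
qed

lemma ip_norm_triangle: "ip_norm ip (u + v) \<le> ip_norm ip u + ip_norm ip v"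
proof -
  have "norm (of_real ((ip_norm ip (u + v))\<^sup>2) :: 'k)
      \<le> ((ip_norm ip u)\<^sup>2 + (ip_norm ip v)\<^sup>2) + (norm (ip u v) + norm (ip u v))"
    unfolding ip_norm_add_sq
    by (rule norm_triangle_le, rule add_mono, simp add: norm_of_real del: of_real_add of_real_power)
       (rule norm_triangle_le, simp)
  then have "(ip_norm ip (u + v))\<^sup>2 \<le> (ip_norm ip u + ip_norm ip v)\<^sup>2"
    using Cauchy_Schwarz[of u v] unfolding norm_of_real by (simp add: power2_sum)
  then show ?thesis by (rule power2_le_imp_le) (simp add: ip_norm_ge0)
qed

lemma Metric_space_ip_dist: "Metric_space UNIV (ip_dist ip)"
proof
  fix x y z
  show "0 \<le> ip_dist ip x y" by (simp add: ip_dist_def ip_norm_ge0)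
  show "ip_dist ip x y = ip_dist ip y x"
    using ip_norm_scale[of "- 1" "x - y"] by (simp add: ip_dist_def)
  show "ip_dist ip x y = 0 \<longleftrightarrow> x = y" by (simp add: ip_dist_def ip_norm_eq_0)
  show "ip_dist ip x z \<le> ip_dist ip x y + ip_dist ip y z"
    using ip_norm_triangle[of "x - y" "y - z"] by (simp add: ip_dist_def)
qed

end

definition ip_topology :: "('v::ab_group_add \<Rightarrow> 'v \<Rightarrow> 'k::rc_field) \<Rightarrow> 'v topology"
  where "ip_topology ip = Metric_space.mtopology UNIV (ip_dist ip)"

locale hilbert_space = pre_hilbert_space +
  assumes complete: "Metric_space.mcomplete UNIV (ip_dist ip)"

text \<open>
  A linear map on a subspace is given by its domain \<open>D\<close> and a total function \<open>T\<close>;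
  values of \<open>T\<close> outside \<open>D\<close> are irrelevant.
\<close>

definition linear_map_on ::
    "('k::field \<Rightarrow> 'v::ab_group_add \<Rightarrow> 'v) \<Rightarrow> ('k \<Rightarrow> 'w::ab_group_add \<Rightarrow> 'w)
     \<Rightarrow> 'v set \<Rightarrow> ('v \<Rightarrow> 'w) \<Rightarrow> bool"
  where "linear_map_on s1 s2 D T \<longleftrightarrow>
    module.subspace s1 D \<and>
    (\<forall>u\<in>D. \<forall>v\<in>D. T (u + v) = T u + T v) \<and>
    (\<forall>c. \<forall>u\<in>D. T (s1 c u) = s2 c (T u))"

definition densely_defined :: "('v::ab_group_add \<Rightarrow> 'v \<Rightarrow> 'k::rc_field) \<Rightarrow> 'v set \<Rightarrow> bool"
  where "densely_defined ip D \<longleftrightarrow> ip_topology ip closure_of D = UNIV"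

definition skew_symmetric ::
    "('v \<Rightarrow> 'v \<Rightarrow> 'k::rc_field) \<Rightarrow> 'v set \<Rightarrow> ('v \<Rightarrow> 'v) \<Rightarrow> bool"
  where "skew_symmetric ip D T \<longleftrightarrow> (\<forall>u\<in>D. \<forall>v\<in>D. ip (T u) v + ip u (T v) = 0)"

definition adjoint_dom ::
    "('v \<Rightarrow> 'v \<Rightarrow> 'k::rc_field) \<Rightarrow> 'v set \<Rightarrow> ('v \<Rightarrow> 'v) \<Rightarrow> 'v set"
  where "adjoint_dom ip D T = {v. \<exists>w. \<forall>u\<in>D. ip (T u) v = ip u w}"

text \<open>For \<open>v \<in> adjoint_dom ip D T\<close> and \<open>D\<close> dense, the vector \<open>w\<close> is unique.\<close>

definition adjoint_op ::
    "('v \<Rightarrow> 'v \<Rightarrow> 'k::rc_field) \<Rightarrow> 'v set \<Rightarrow> ('v \<Rightarrow> 'v) \<Rightarrow> 'v \<Rightarrow> 'v"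
  where "adjoint_op ip D T v = (THE w. \<forall>u\<in>D. ip (T u) v = ip u w)"

definition neg_adjoint ::
    "('v::ab_group_add \<Rightarrow> 'v \<Rightarrow> 'k::rc_field) \<Rightarrow> 'v set \<Rightarrow> ('v \<Rightarrow> 'v) \<Rightarrow> 'v \<Rightarrow> 'v"
  where "neg_adjoint ip D T v = - adjoint_op ip D T v"

definition graph_norm ::
    "('v \<Rightarrow> 'v \<Rightarrow> 'k::rc_field) \<Rightarrow> ('v \<Rightarrow> 'v) \<Rightarrow> 'v \<Rightarrow> real"
  where "graph_norm ip T u = sqrt ((ip_norm ip u)\<^sup>2 + (ip_norm ip (T u))\<^sup>2)"

definition graph_topology ::
    "('v::ab_group_add \<Rightarrow> 'v \<Rightarrow> 'k::rc_field) \<Rightarrow> 'v set \<Rightarrow> ('v \<Rightarrow> 'v) \<Rightarrow> 'v topology"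
  where "graph_topology ip D T = Metric_space.mtopology D (\<lambda>u v. graph_norm ip T (u - v))"

locale boundary_quadruple =
  Hm: pre_hilbert_space sm ipm + Hp: pre_hilbert_space sp ipp
  for sm :: "'k::rc_field \<Rightarrow> 'm::ab_group_add \<Rightarrow> 'm" and ipm :: "'m \<Rightarrow> 'm \<Rightarrow> 'k"
    and sp :: "'k \<Rightarrow> 'p::ab_group_add \<Rightarrow> 'p" and ipp :: "'p \<Rightarrow> 'p \<Rightarrow> 'k" +
  fixes sV :: "'k \<Rightarrow> 'v::ab_group_add \<Rightarrow> 'v" and ipV :: "'v \<Rightarrow> 'v \<Rightarrow> 'k"
    and D0 :: "'v set" and A0 :: "'v \<Rightarrow> 'v"
    and Gm :: "'v \<Rightarrow> 'm" and Gp :: "'v \<Rightarrow> 'p"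
  assumes Gm_linear: "linear_map_on sV sm (adjoint_dom ipV D0 A0) Gm"
    and Gp_linear: "linear_map_on sV sp (adjoint_dom ipV D0 A0) Gp"
    and Gm_surj: "Gm ` adjoint_dom ipV D0 A0 = UNIV"
    and Gp_surj: "Gp ` adjoint_dom ipV D0 A0 = UNIV"
    and green: "u \<in> adjoint_dom ipV D0 A0 \<Longrightarrow> v \<in> adjoint_dom ipV D0 A0 \<Longrightarrow>
          ipV (neg_adjoint ipV D0 A0 u) v + ipV u (neg_adjoint ipV D0 A0 v)
          = ipp (Gp u) (Gp v) - ipm (Gm u) (Gm v)"
    and ker_sum: "{u + v | u v. u \<in> adjoint_dom ipV D0 A0 \<and> Gm u = 0 \<and>
                               v \<in> adjoint_dom ipV D0 A0 \<and> Gp v = 0}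
                  = adjoint_dom ipV D0 A0"

end

theory Submission
  imports Defs
begin

text \<open>
  Green's identity makes \<open>u \<mapsto> \<langle>G\<^sub>+ u, G\<^sub>+ v\<rangle>\<close> graph-norm continuous for each
  \<open>v \<in> ker G\<^sub>-\<close>. Since \<open>ker G\<^sub>- + ker G\<^sub>+ = D(A)\<close>, already \<open>G\<^sub>+\<close> restricted to \<open>ker G\<^sub>-\<close>
  is onto \<open>H\<^sub>+\<close>, so \<open>u \<mapsto> \<langle>G\<^sub>+ u, h\<rangle>\<close> is continuous for every \<open>h \<in> H\<^sub>+\<close>. As \<open>A\<close> is closed,
  \<open>D(A)\<close> is complete in the graph norm, and the uniform boundedness principle, which needs no
  completeness of \<open>H\<^sub>+\<close>, bounds \<open>G\<^sub>+\<close>. The argument for \<open>G\<^sub>-\<close> is symmetric.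
\<close>

section \<open>Sesquilinear algebra and orthogonality to dense sets\<close>

context pre_hilbert_space
begin

lemma ip_zero_right [simp]: "ip u 0 = 0"
  using ip_add_right[of u 0 0] by simp

lemma ip_zero_left [simp]: "ip 0 u = 0"
  using ip_add_left[of 0 0 u] by simp

lemma ip_minus_right: "ip u (- v) = - ip u v"
  using ip_add_right[of u v "- v"] by (simp add: eq_neg_iff_add_eq_0 add.commute)

lemma ip_minus_left: "ip (- u) v = - ip u v"
  using ip_add_left[of u "- u" v] by (simp add: eq_neg_iff_add_eq_0 add.commute)

lemma ip_diff_left: "ip (u - v) w = ip u w - ip v w"
  using ip_add_left[of u "- v" w] by (simp add: ip_minus_left)

lemma ip_diff_right: "ip w (u - v) = ip w u - ip w v"
  using ip_add_right[of w u "- v"] by (simp add: ip_minus_right)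

lemma norm_ip_self: "norm (ip u u) = (ip_norm ip u)\<^sup>2"
  by (simp add: ip_norm_def)

lemma ip_norm_minus: "ip_norm ip (- u) = ip_norm ip u"
  by (simp add: ip_norm_def ip_minus_left ip_minus_right)

text \<open>If \<open>w\<close> were nonzero, some \<open>x\<close> in \<open>D\<close> would be
  closer to \<open>w\<close> than \<open>ip_norm ip w\<close>. As \<open>ip x w = 0\<close>, this
  contradicts Cauchy-Schwarz for \<open>ip (w - x) w = ip w w\<close>.\<close>

lemma dense_orthogonal_eq_0:
  assumes dense: "densely_defined ip D" and orth: "\<And>x. x \<in> D \<Longrightarrow> ip x w = 0"
  shows "w = 0"
proof (rule ccontr)
  interpret M: Metric_space UNIV "ip_dist ip" by (rule Metric_space_ip_dist)
  assume "w \<noteq> 0"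
  then have pos: "ip_norm ip w > 0"
    using ip_norm_ge0[of w] ip_norm_eq_0[of w] by linarith
  have "w \<in> M.mtopology closure_of D"
    using dense by (simp add: densely_defined_def ip_topology_def)
  then obtain x where x: "x \<in> D" "ip_norm ip (w - x) < ip_norm ip w"
    using pos unfolding M.metric_closure_of by (auto simp: ip_dist_def)
  have "(ip_norm ip w)\<^sup>2 = norm (ip (w - x) w)"
    using orth[OF x(1)] by (simp add: ip_diff_left norm_ip_self)
  also have "\<dots> \<le> ip_norm ip (w - x) * ip_norm ip w"
    by (rule Cauchy_Schwarz)
  also have "\<dots> < ip_norm ip w * ip_norm ip w"
    using x(2) pos by simp
  finally show False by (simp add: power2_eq_square)
qed

section \<open>The negative adjoint\<close>

text \<open>Density makes the representing vector unique, so the \<open>THE\<close> in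
  \<open>adjoint_op\<close> picks it. The graph of the negative adjoint thus becomes a condition on
  \<open>(v, w)\<close> that is additive, conjugate-homogeneous and continuous; linearity and
  closedness are both read off from it.\<close>

lemma adjoint_dom_neg_adjoint_iff:
  assumes dense: "densely_defined ip D"
  shows "v \<in> adjoint_dom ip D T \<and> neg_adjoint ip D T v = w
    \<longleftrightarrow> (\<forall>x\<in>D. ip (T x) v + ip x w = 0)"
proof -
  have uniq: "w1 = w2"
    if "\<forall>x\<in>D. ip (T x) v = ip x w1" "\<forall>x\<in>D. ip (T x) v = ip x w2" for w1 w2
  proof -
    have "w1 - w2 = 0"
      by (rule dense_orthogonal_eq_0[OF dense]) (metis that ip_diff_right right_minus_eq)
    then show ?thesis by simp
  qed
  have adj: "adjoint_op ip D T v = w'" if "\<forall>x\<in>D. ip (T x) v = ip x w'" for w'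
    unfolding adjoint_op_def using that uniq by (intro the_equality) auto
  show ?thesis
  proof (intro iffI conjI)
    assume "v \<in> adjoint_dom ip D T \<and> neg_adjoint ip D T v = w"
    then obtain w' where w': "\<forall>x\<in>D. ip (T x) v = ip x w'" and w: "neg_adjoint ip D T v = w"
      by (auto simp: adjoint_dom_def)
    have "w = - w'" using w adj[OF w'] by (simp add: neg_adjoint_def)
    then show "\<forall>x\<in>D. ip (T x) v + ip x w = 0"
      using w' by (simp add: ip_minus_right)
  next
    assume "\<forall>x\<in>D. ip (T x) v + ip x w = 0"
    then have w': "\<forall>x\<in>D. ip (T x) v = ip x (- w)"
      by (simp add: ip_minus_right eq_neg_iff_add_eq_0)
    show "v \<in> adjoint_dom ip D T" using w' by (auto simp: adjoint_dom_def)
    show "neg_adjoint ip D T v = w" using adj[OF w'] by (simp add: neg_adjoint_def)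
  qed
qed

lemma linear_map_on_neg_adjoint:
  assumes dense: "densely_defined ip D"
  shows "linear_map_on scale scale (adjoint_dom ip D T) (neg_adjoint ip D T)"
proof -
  let ?D = "adjoint_dom ip D T" and ?A = "neg_adjoint ip D T"
  note iff = adjoint_dom_neg_adjoint_iff[OF dense, of _ T]
  have graph: "ip (T x) v + ip x (?A v) = 0" if "v \<in> ?D" "x \<in> D" for v x
    using iff[of v "?A v"] that by blast
  have add: "u + v \<in> ?D \<and> ?A (u + v) = ?A u + ?A v" if "u \<in> ?D" "v \<in> ?D" for u v
    \<comment> \<open>Membership in the domain and the value there are settled together, by testing
      the expected value as \<open>w\<close>.\<close>
    unfolding iff
  proof
    fix x assume "x \<in> D"
    with that show "ip (T x) (u + v) + ip x (?A u + ?A v) = 0"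
      using graph[of u x] graph[of v x]
      by (simp add: ip_add_right add_eq_0_iff algebra_simps)
  qed
  have sc: "scale c v \<in> ?D \<and> ?A (scale c v) = scale c (?A v)" if "v \<in> ?D" for c v
    unfolding iff
  proof
    fix x assume "x \<in> D"
    with that show "ip (T x) (scale c v) + ip x (scale c (?A v)) = 0"
      using graph[of v x] by (simp add: ip_scale_right distrib_left[symmetric])
  qed
  have "0 \<in> ?D \<and> ?A 0 = 0" unfolding iff by simp
  then show ?thesis
    unfolding linear_map_on_def subspace_def using add sc by blast
qed

section \<open>The graph norm as a metric\<close>

lemma graph_norm_ge0: "0 \<le> graph_norm ip T u"
  by (simp add: graph_norm_def)

lemma ip_norm_le_graph_norm: "ip_norm ip u \<le> graph_norm ip T u"
  by (simp add: graph_norm_def real_le_rsqrt)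

lemma ip_norm_image_le_graph_norm: "ip_norm ip (T u) \<le> graph_norm ip T u"
  by (simp add: graph_norm_def real_le_rsqrt)

lemma linear_map_on_diff:
  assumes "linear_map_on scale s2 D T" "u \<in> D" "v \<in> D"
  shows "u - v \<in> D" "T (u - v) = T u - T v"
proof -
  show d: "u - v \<in> D"
    using assms by (auto simp: linear_map_on_def intro: subspace_diff)
  have "T (u - v + v) = T (u - v) + T v"
    using assms d unfolding linear_map_on_def by blast
  then show "T (u - v) = T u - T v" by simp
qed


text \<open>
  \<open>Metric_space\<close> demands symmetry of the distance on the whole type, so the values of \<open>T\<close>
  outside \<open>D\<close> do matter here.
\<close>

lemma Metric_space_graph_norm:
  assumes lin: "linear_map_on scale scale D T"
    and sym: "\<And>u. graph_norm ip T (- u) = graph_norm ip T u"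
  shows "Metric_space D (\<lambda>u v. graph_norm ip T (u - v))"
proof
  note diff = linear_map_on_diff[OF lin]
  fix x y z
  show "0 \<le> graph_norm ip T (x - y)" by (rule graph_norm_ge0)
  show "graph_norm ip T (x - y) = graph_norm ip T (y - x)"
    using sym[of "x - y"] by simp
  assume x: "x \<in> D" and y: "y \<in> D"
  show "graph_norm ip T (x - y) = 0 \<longleftrightarrow> x = y"
    using diff(2)[OF x x] by (auto simp: graph_norm_def sum_power2_eq_zero_iff ip_norm_eq_0)
  assume z: "z \<in> D"
  have T: "T (x - z) = T (x - y) + T (y - z)"
    using diff(2)[OF x z] diff(2)[OF x y] diff(2)[OF y z] by simp
  have "(ip_norm ip (x - z))\<^sup>2 \<le> (ip_norm ip (x - y) + ip_norm ip (y - z))\<^sup>2"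
    using ip_norm_triangle[of "x - y" "y - z"] by (intro power_mono) (auto simp: ip_norm_ge0)
  moreover have "(ip_norm ip (T (x - z)))\<^sup>2 \<le> (ip_norm ip (T (x - y)) + ip_norm ip (T (y - z)))\<^sup>2"
    unfolding T by (intro power_mono ip_norm_triangle ip_norm_ge0)
  \<comment> \<open>Both components obey the triangle inequality; Minkowski's inequality in the
    Euclidean plane combines them.\<close>
  ultimately show "graph_norm ip T (x - z) \<le> graph_norm ip T (x - y) + graph_norm ip T (y - z)"
    unfolding graph_norm_def
    by (intro order_trans[OF _ real_sqrt_sum_squares_triangle_ineq] real_sqrt_le_mono add_mono)
qed

text \<open>Supplies the symmetry of the graph distance on the whole type. On the domain it is
  linearity; off the domain it depends on how \<open>THE\<close> treats an unsatisfiable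
  predicate.\<close>

lemma graph_norm_neg_adjoint_minus:
  assumes dense: "densely_defined ip D"
  shows "graph_norm ip (neg_adjoint ip D T) (- u) = graph_norm ip (neg_adjoint ip D T) u"
proof -
  let ?D = "adjoint_dom ip D T" and ?A = "neg_adjoint ip D T"
  note lin = linear_map_on_neg_adjoint[OF dense, of T]
  have sub: "subspace ?D" using lin by (simp add: linear_map_on_def)
  have "ip_norm ip (?A (- u)) = ip_norm ip (?A u)"
  proof (cases "u \<in> ?D")
    case True
    then have "?A (- u) = - ?A u"
      using linear_map_on_diff[OF lin, of 0 u]
        linear_map_on_diff[OF lin, of u u] subspace_0[OF sub] by simp
    then show ?thesis by (simp add: ip_norm_minus)
  next
    case False
    then have "- u \<notin> ?D" using subspace_neg[OF sub, of "- u"] by auto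
    \<comment> \<open>Neither \<open>u\<close> nor \<open>- u\<close> has a representing vector, so
      both predicates are constantly false and their \<open>THE\<close> terms are the same
      unspecified value.\<close>
    with False have "(\<lambda>w. \<forall>x\<in>D. ip (T x) (- u) = ip x w) = (\<lambda>w. \<forall>x\<in>D. ip (T x) u = ip x w)"
      unfolding adjoint_dom_def by (intro ext) blast
    then show ?thesis by (simp add: neg_adjoint_def adjoint_op_def)
  qed
  then show ?thesis by (simp add: graph_norm_def ip_norm_minus)
qed

lemma Metric_space_graph_norm_neg_adjoint:
  assumes "densely_defined ip D"
  shows "Metric_space (adjoint_dom ip D T)
    (\<lambda>u v. graph_norm ip (neg_adjoint ip D T) (u - v))"
  using assms
  by (intro Metric_space_graph_norm linear_map_on_neg_adjoint graph_norm_neg_adjoint_minus)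

lemma graph_norm_scale:
  assumes "linear_map_on scale scale D T" "u \<in> D"
  shows "graph_norm ip T (scale c u) = norm c * graph_norm ip T u"
proof -
  have "T (scale c u) = scale c (T u)" using assms by (simp add: linear_map_on_def)
  then show ?thesis
    by (simp add: graph_norm_def ip_norm_scale power_mult_distrib distrib_left[symmetric]
        real_sqrt_mult)
qed

section \<open>Uniform boundedness and continuity\<close>

text \<open>Baire's theorem in \<open>D\<close>: the sets \<open>E n\<close> are closed by weak
  boundedness and cover \<open>D\<close>, so one contains a ball; translation to the origin and
  scaling turn this into a global bound.\<close>

lemma uniform_boundedness:
  fixes sV :: "'k \<Rightarrow> 'w::ab_group_add \<Rightarrow> 'w"
  assumes V: "vector_space sV"
    and met: "Metric_space D (\<lambda>u v. N (u - v))"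
    and compl: "Metric_space.mcomplete D (\<lambda>u v. N (u - v))"
    and Nscale: "\<And>c u. u \<in> D \<Longrightarrow> N (sV c u) = norm c * N u"
    and lin: "linear_map_on sV scale D G"
    and weak: "\<And>h. \<exists>C. \<forall>u\<in>D. norm (ip (G u) h) \<le> C * N u"
  shows "\<exists>C. \<forall>u\<in>D. ip_norm ip (G u) \<le> C * N u"
proof -
  interpret V: vector_space sV by fact
  interpret M: Metric_space D "\<lambda>u v. N (u - v)" by fact
  have sub: "V.subspace D" using lin by (simp add: linear_map_on_def)
  have Gadd: "G (u + v) = G u + G v" if "u \<in> D" "v \<in> D" for u v
    using lin that by (simp add: linear_map_on_def)
  have Gscale: "G (sV c u) = scale c (G u)" if "u \<in> D" for c u
    using lin that by (simp add: linear_map_on_def)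
  have D0: "0 \<in> D" by (rule V.subspace_0[OF sub])
  have N0: "0 \<le> N u" for u
    using M.nonneg[of u 0] by simp
  have Ncomm: "N (- u) = N u" for u
    using M.commute[of 0 u] by simp
  define E where "E n = {u \<in> D. ip_norm ip (G u) \<le> real n}" for n :: nat
  have Un: "(\<Union>(range E)) = D"
    unfolding E_def using real_arch_simple by auto
  have closed: "closedin M.mtopology (E n)" for n
  proof -
    \<comment> \<open>The complement of \<open>E n\<close> is open: a point \<open>u\<close> outside
      is separated by testing against \<open>h = G u\<close> itself.\<close>
    have "\<exists>r>0. disjnt (E n) (M.mball u r)" if u: "u \<in> D - E n" for u
    proof -
      define h where "h = G u"
      have gt: "ip_norm ip h > real n" using u by (auto simp: E_def h_def)
      then have hpos: "ip_norm ip h > 0" by (smt (verit) of_nat_0_le_iff)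
      obtain C where C: "\<And>v. v \<in> D \<Longrightarrow> norm (ip (G v) h) \<le> C * N v"
        using weak by blast
      \<comment> \<open>\<open>C\<close> may be zero or negative, while the radius below needs a
        positive divisor.\<close>
      define C' where "C' = \<bar>C\<bar> + 1"
      have C': "C' > 0" "\<And>v. v \<in> D \<Longrightarrow> norm (ip (G v) h) \<le> C' * N v"
      proof -
        fix v assume "v \<in> D"
        have "C * N v \<le> C' * N v" using N0[of v] by (intro mult_right_mono) (auto simp: C'_def)
        then show "norm (ip (G v) h) \<le> C' * N v" using C[OF \<open>v \<in> D\<close>] by linarith
      qed (simp add: C'_def)
      \<comment> \<open>Chosen so that \<open>C' * r + real n * ip_norm ip h\<close> equals the
        square of \<open>ip_norm ip h\<close>.\<close>
      define r where "r = (ip_norm ip h - real n) * ip_norm ip h / C'"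
      have r: "r > 0" using gt hpos C'(1) by (simp add: r_def)
      have False if x: "x \<in> E n" and d: "N (u - x) < r" for x
      proof -
        have xD: "x \<in> D" and xn: "ip_norm ip (G x) \<le> real n" using x by (auto simp: E_def)
        have uxD: "u - x \<in> D" using u xD V.subspace_diff[OF sub] by blast
        have "ip (G u) h = ip (G (u - x)) h + ip (G x) h"
          using Gadd[OF uxD xD] by (simp add: ip_add_left)
        then have "(ip_norm ip h)\<^sup>2 \<le> norm (ip (G (u - x)) h) + norm (ip (G x) h)"
          using norm_ip_self[of h] norm_triangle_ineq by (metis h_def)
        also have "\<dots> \<le> C' * N (u - x) + ip_norm ip (G x) * ip_norm ip h"
          by (intro add_mono C'(2) uxD Cauchy_Schwarz)
        also have "\<dots> < C' * r + real n * ip_norm ip h"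
          using d xn C'(1) hpos by (intro add_less_le_mono mult_right_mono) auto
        also have "\<dots> = (ip_norm ip h)\<^sup>2"
          using C'(1) by (simp add: r_def power2_eq_square field_simps)
        finally show False by simp
      qed
      then show ?thesis using r by (auto simp: disjnt_iff)
    qed
    moreover have "E n \<subseteq> D" by (auto simp: E_def)
    ultimately show ?thesis unfolding M.closedin_metric by blast
  qed
  \<comment> \<open>\<open>D\<close> contains 0, so the union of the \<open>E n\<close> has nonempty
    interior, and by Baire some \<open>E n\<close> does too.\<close>
  have "M.mtopology interior_of D \<noteq> {}"
    using D0 interior_of_topspace[of M.mtopology] by (auto simp: M.topspace_mtopology)
  then obtain n where "M.mtopology interior_of (E n) \<noteq> {}"
    using M.metric_Baire_category_alt[OF compl, of "range E"] closed Un by auto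
  then obtain u0 r where u0: "u0 \<in> D" and r: "r > 0" and ball: "M.mball u0 r \<subseteq> E n"
    unfolding M.metric_interior_of by auto
  \<comment> \<open>Both \<open>u0 + x\<close> and the centre \<open>u0\<close> lie in the ball, and
    \<open>x\<close> is their difference; hence the factor 2.\<close>
  have small: "ip_norm ip (G x) \<le> 2 * real n" if x: "x \<in> D" and xr: "N x < r" for x
  proof -
    have "u0 + x \<in> D" using V.subspace_add[OF sub u0 x] .
    then have "u0 + x \<in> E n" "u0 \<in> E n"
      using ball u0 r Ncomm[of x] xr by auto
    moreover have "G x = G (u0 + x) + - G u0" using Gadd[OF u0 x] by simp
    ultimately show ?thesis
      using ip_norm_triangle[of "G (u0 + x)" "- G u0"] by (simp add: E_def ip_norm_minus)
  qed
  have "ip_norm ip (G x) \<le> (4 * real n / r) * N x" if x: "x \<in> D" for x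
  proof (cases "x = 0")
    case True
    have "G 0 = 0" using Gadd[OF D0 D0] by simp
    then show ?thesis using True N0[of x] r by (simp add: ip_norm_def)
  next
    case False
    then have Nx: "N x > 0"
      using M.zero[OF x D0] N0[of x] by (simp add: order_less_le)
    \<comment> \<open>Scales \<open>x\<close> to \<open>N\<close>-length \<open>r / 2\<close>,
      inside the ball of \<open>small\<close>; dividing \<open>2 * real n\<close> by
      \<open>t\<close> gives the constant \<open>4 * real n / r * N x\<close>.\<close>
    define t where "t = r / (2 * N x)"
    have t: "t > 0" using Nx r by (simp add: t_def)
    have "N (sV (of_real t) x) = t * N x"
      using Nscale[OF x, of "of_real t"] t by simp
    also have "\<dots> < r" using Nx r by (simp add: t_def)
    finally have "N (sV (of_real t) x) < r" .
    moreover have "sV (of_real t) x \<in> D" by (rule V.subspace_scale[OF sub x])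
    ultimately have "ip_norm ip (G (sV (of_real t) x)) \<le> 2 * real n" by (rule small[rotated])
    then have "t * ip_norm ip (G x) \<le> 2 * real n"
      using t by (simp add: Gscale[OF x] ip_norm_scale)
    then show ?thesis using Nx r by (simp add: t_def field_simps)
  qed
  then show ?thesis by blast
qed

lemma continuous_map_ip_topology:
  fixes sV :: "'k \<Rightarrow> 'w::ab_group_add \<Rightarrow> 'w"
  assumes V: "vector_space sV"
    and met: "Metric_space D (\<lambda>u v. N (u - v))"
    and lin: "linear_map_on sV scale D G"
    and bound: "\<And>u. u \<in> D \<Longrightarrow> ip_norm ip (G u) \<le> C * N u"
  shows "continuous_map (Metric_space.mtopology D (\<lambda>u v. N (u - v))) (ip_topology ip) G"
proof -
  interpret V: vector_space sV by fact
  interpret M: Metric_space D "\<lambda>u v. N (u - v)" by fact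
  have sub: "V.subspace D" using lin by (simp add: linear_map_on_def)
  have *: "ip_dist ip (G a) (G x) \<le> \<bar>C\<bar> * N (a - x)" if "a \<in> D" "x \<in> D" for a x
  proof -
    have d: "a - x \<in> D" using V.subspace_diff[OF sub that] .
    have "G (a - x + x) = G (a - x) + G x" using lin d that unfolding linear_map_on_def by blast
    then have "ip_dist ip (G a) (G x) \<le> C * N (a - x)"
      using bound[OF d] by (simp add: ip_dist_def)
    also have "\<dots> \<le> \<bar>C\<bar> * N (a - x)"
      by (intro mult_right_mono M.nonneg) simp
    finally show ?thesis .
  qed
  have "\<exists>\<delta>>0. \<forall>x. x \<in> D \<and> N (a - x) < \<delta> \<longrightarrow> ip_dist ip (G a) (G x) < \<epsilon>"
    if a: "a \<in> D" and e: "\<epsilon> > 0" for a and \<epsilon> :: real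
  proof (intro exI conjI allI impI)
    \<comment> \<open>The \<open>+ 1\<close> keeps the denominator positive when
      \<open>C = 0\<close>.\<close>
    show "\<epsilon> / (\<bar>C\<bar> + 1) > 0" using e by simp
    fix x assume x: "x \<in> D \<and> N (a - x) < \<epsilon> / (\<bar>C\<bar> + 1)"
    have "ip_dist ip (G a) (G x) \<le> (\<bar>C\<bar> + 1) * N (a - x)"
      using *[OF a, of x] x M.nonneg[of a x] unfolding distrib_right by linarith
    also have "\<dots> < \<epsilon>" using x by (simp add: field_simps)
    finally show "ip_dist ip (G a) (G x) < \<epsilon>" .
  qed
  then show ?thesis
    unfolding ip_topology_def M.metric_continuous_map[OF Metric_space_ip_dist] by auto
qed

text \<open>For fixed \<open>v\<close>, the left side of Green's identity is bounded in
  \<open>u\<close> by the graph norm, with a constant depending on \<open>v\<close> alone.\<close>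

lemma norm_Green_form_le:
  "norm (ip (T u) v + ip u (T v)) \<le> (ip_norm ip v + ip_norm ip (T v)) * graph_norm ip T u"
proof -
  have "norm (ip (T u) v + ip u (T v))
      \<le> ip_norm ip (T u) * ip_norm ip v + ip_norm ip u * ip_norm ip (T v)"
    by (intro norm_triangle_le add_mono Cauchy_Schwarz)
  also have "\<dots> \<le> graph_norm ip T u * ip_norm ip v + graph_norm ip T u * ip_norm ip (T v)"
    by (intro add_mono mult_right_mono ip_norm_le_graph_norm ip_norm_image_le_graph_norm
        ip_norm_ge0)
  finally show ?thesis by (simp add: algebra_simps)
qed

end

section \<open>Closedness of the negative adjoint and completeness of its graph\<close>

context hilbert_space
begin

text \<open>A graph-Cauchy sequence and its image both converge in the Hilbert space, to
  \<open>u\<close> and \<open>w\<close>. The condition characterising the graph survives the limit,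
  so \<open>u\<close> is in the domain with image \<open>w\<close>.\<close>

lemma mcomplete_graph_norm_neg_adjoint:
  assumes dense: "densely_defined ip D"
  shows "Metric_space.mcomplete (adjoint_dom ip D T)
    (\<lambda>u v. graph_norm ip (neg_adjoint ip D T) (u - v))"
proof -
  let ?D = "adjoint_dom ip D T" and ?A = "neg_adjoint ip D T"
  note lin = linear_map_on_neg_adjoint[OF dense, of T]
  note diff = linear_map_on_diff[OF lin]
  note iff = adjoint_dom_neg_adjoint_iff[OF dense, of _ T]
  interpret M: Metric_space UNIV "ip_dist ip" by (rule Metric_space_ip_dist)
  interpret G: Metric_space ?D "\<lambda>u v. graph_norm ip ?A (u - v)"
    by (rule Metric_space_graph_norm_neg_adjoint[OF dense])
  show ?thesis
    unfolding G.mcomplete_def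
  proof (intro allI impI)
    fix \<sigma> assume "G.MCauchy \<sigma>"
    then have D: "\<sigma> n \<in> ?D" for n
      unfolding G.MCauchy_def by auto
    have C: "\<And>\<epsilon>. \<epsilon> > 0 \<Longrightarrow>
        \<exists>N. \<forall>n n'. N \<le> n \<longrightarrow> N \<le> n' \<longrightarrow> graph_norm ip ?A (\<sigma> n - \<sigma> n') < \<epsilon>"
      using \<open>G.MCauchy \<sigma>\<close>
      unfolding G.MCauchy_def by auto
    have "M.MCauchy \<sigma>"
      unfolding M.MCauchy_def ip_dist_def
      using C ip_norm_le_graph_norm by (meson order_le_less_trans subset_UNIV)
    then obtain u where u: "limitin M.mtopology \<sigma> u sequentially"
      using complete unfolding M.mcomplete_def by blast
    have "ip_norm ip (?A (\<sigma> n) - ?A (\<sigma> n')) \<le> graph_norm ip ?A (\<sigma> n - \<sigma> n')" for n n'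
      using diff(2)[OF D D] ip_norm_image_le_graph_norm by metis
    then have "M.MCauchy (\<lambda>n. ?A (\<sigma> n))"
      unfolding M.MCauchy_def ip_dist_def
      using C by (meson order_le_less_trans subset_UNIV)
    then obtain w where w: "limitin M.mtopology (\<lambda>n. ?A (\<sigma> n)) w sequentially"
      using complete unfolding M.mcomplete_def by blast
    have u0: "(\<lambda>n. ip_norm ip (\<sigma> n - u)) \<longlonglongrightarrow> 0"
      using u by (simp add: M.limitin_metric_dist_null ip_dist_def)
    have w0: "(\<lambda>n. ip_norm ip (?A (\<sigma> n) - w)) \<longlonglongrightarrow> 0"
      using w by (simp add: M.limitin_metric_dist_null ip_dist_def)
    have "ip (T x) u + ip x w = 0" if x: "x \<in> D" for x
    proof -
      \<comment> \<open>The defect of the limit pair. It vanishes for each \<open>\<sigma> n\<close>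
        and its image, so up to sign it is the form evaluated at the two error terms.\<close>
      define c where "c = ip (T x) u + ip x w"
      have "norm c \<le> ip_norm ip (T x) * ip_norm ip (\<sigma> n - u)
          + ip_norm ip x * ip_norm ip (?A (\<sigma> n) - w)" for n
      proof -
        have "ip (T x) (\<sigma> n) + ip x (?A (\<sigma> n)) = 0" using iff D x by blast
        then have "- c = ip (T x) (\<sigma> n - u) + ip x (?A (\<sigma> n) - w)"
          by (simp add: c_def ip_diff_right algebra_simps)
        then have "norm c = norm (ip (T x) (\<sigma> n - u) + ip x (?A (\<sigma> n) - w))"
          by (metis norm_minus_cancel)
        also have "\<dots> \<le> ip_norm ip (T x) * ip_norm ip (\<sigma> n - u)
          + ip_norm ip x * ip_norm ip (?A (\<sigma> n) - w)"
          by (intro norm_triangle_le add_mono Cauchy_Schwarz)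
        finally show ?thesis .
      qed
      moreover have "(\<lambda>n. ip_norm ip (T x) * ip_norm ip (\<sigma> n - u)
          + ip_norm ip x * ip_norm ip (?A (\<sigma> n) - w)) \<longlonglongrightarrow> 0"
        using tendsto_add[OF tendsto_mult_right_zero[OF u0] tendsto_mult_right_zero[OF w0]] by simp
      ultimately have "norm c \<le> 0"
        by (intro LIMSEQ_le_const) auto
      then show ?thesis by (simp add: c_def)
    qed
    then have uD: "u \<in> ?D" and Au: "?A u = w" using iff[of u w] by auto
    have "(\<lambda>n. sqrt ((ip_norm ip (\<sigma> n - u))\<^sup>2 + (ip_norm ip (?A (\<sigma> n) - w))\<^sup>2))
        \<longlonglongrightarrow> sqrt (0\<^sup>2 + 0\<^sup>2)"
      by (intro tendsto_intros u0 w0)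
    then have "(\<lambda>n. graph_norm ip ?A (\<sigma> n - u)) \<longlonglongrightarrow> 0"
      using diff(2)[OF D uD] by (simp add: graph_norm_def Au)
    then have "limitin G.mtopology \<sigma> u sequentially"
      using uD D by (simp add: G.limitin_metric_dist_null)
    then show "\<exists>u. limitin G.mtopology \<sigma> u sequentially" by blast
  qed
qed

text \<open>Shared by both boundary maps: \<open>weak\<close> compares only norms, so the opposite
  signs of the two boundary terms in Green's identity do not matter.\<close>

lemma continuous_map_graph_topology:
  fixes sH :: "'a \<Rightarrow> 'h::ab_group_add \<Rightarrow> 'h"
  assumes dense: "densely_defined ip D"
    and H: "pre_hilbert_space sH ipH"
    and lin: "linear_map_on scale sH (adjoint_dom ip D T) G"
    and weak: "\<And>h. \<exists>v. \<forall>u\<in>adjoint_dom ip D T. norm (ipH (G u) h)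
        = norm (ip (neg_adjoint ip D T u) v + ip u (neg_adjoint ip D T v))"
  shows "continuous_map (graph_topology ip (adjoint_dom ip D T) (neg_adjoint ip D T))
    (ip_topology ipH) G"
proof -
  let ?D = "adjoint_dom ip D T" and ?A = "neg_adjoint ip D T"
  interpret H: pre_hilbert_space sH ipH by fact
  note met = Metric_space_graph_norm_neg_adjoint[OF dense, of T]
  have "\<exists>C. \<forall>u\<in>?D. norm (ipH (G u) h) \<le> C * graph_norm ip ?A u" for h
    using weak[of h] norm_Green_form_le by metis
  then obtain C where "\<And>u. u \<in> ?D \<Longrightarrow> ip_norm ipH (G u) \<le> C * graph_norm ip ?A u"
    using H.uniform_boundedness[OF vector_space_axioms met
        mcomplete_graph_norm_neg_adjoint[OF dense]
        graph_norm_scale[OF linear_map_on_neg_adjoint[OF dense]] lin] by blast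
  then show ?thesis
    unfolding graph_topology_def
    by (rule H.continuous_map_ip_topology[OF vector_space_axioms met lin])
qed

end

section \<open>Continuity of the two boundary maps\<close>

theorem lemma3p4:
  fixes sV :: "'k::rc_field \<Rightarrow> 'v::ab_group_add \<Rightarrow> 'v" and ipV :: "'v \<Rightarrow> 'v \<Rightarrow> 'k"
    and D0 :: "'v set" and A0 :: "'v \<Rightarrow> 'v"
    and sm :: "'k \<Rightarrow> 'm::ab_group_add \<Rightarrow> 'm" and ipm :: "'m \<Rightarrow> 'm \<Rightarrow> 'k"
    and sp :: "'k \<Rightarrow> 'p::ab_group_add \<Rightarrow> 'p" and ipp :: "'p \<Rightarrow> 'p \<Rightarrow> 'k"
    and Gm :: "'v \<Rightarrow> 'm" and Gp :: "'v \<Rightarrow> 'p"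
  assumes "hilbert_space sV ipV"
    and "linear_map_on sV sV D0 A0"
    and "densely_defined ipV D0"
    and "skew_symmetric ipV D0 A0"
    and "boundary_quadruple sm ipm sp ipp sV ipV D0 A0 Gm Gp"
  shows "continuous_map
           (graph_topology ipV (adjoint_dom ipV D0 A0) (neg_adjoint ipV D0 A0))
           (ip_topology ipm) Gm
       \<and> continuous_map
           (graph_topology ipV (adjoint_dom ipV D0 A0) (neg_adjoint ipV D0 A0))
           (ip_topology ipp) Gp"
proof -
  interpret V: hilbert_space sV ipV by fact
  interpret boundary_quadruple sm ipm sp ipp sV ipV D0 A0 Gm Gp by fact
  let ?D = "adjoint_dom ipV D0 A0" and ?A = "neg_adjoint ipV D0 A0"
  have decomp: "\<exists>a b. v = a + b \<and> a \<in> ?D \<and> Gm a = 0 \<and> b \<in> ?D \<and> Gp b = 0" if "v \<in> ?D" for v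
    using that ker_sum by blast
  have Gm_add: "Gm (a + b) = Gm a + Gm b" if "a \<in> ?D" "b \<in> ?D" for a b
    using Gm_linear that by (simp add: linear_map_on_def)
  have Gp_add: "Gp (a + b) = Gp a + Gp b" if "a \<in> ?D" "b \<in> ?D" for a b
    using Gp_linear that by (simp add: linear_map_on_def)
  have "\<exists>v. \<forall>u\<in>?D. norm (ipm (Gm u) h) = norm (ipV (?A u) v + ipV u (?A v))" for h
  proof -
    obtain v where v: "v \<in> ?D" "h = Gm v" using Gm_surj by (metis UNIV_I imageE)
    then obtain a b where "v = a + b" "a \<in> ?D" "Gm a = 0" and b: "b \<in> ?D" "Gp b = 0"
      using decomp by blast
    \<comment> \<open>Removing the part of \<open>v\<close> in the kernel of \<open>Gm\<close>
      leaves the boundary value unchanged. Since \<open>Gp b = 0\<close>, Green's identity at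
      \<open>b\<close> retains only the \<open>Gm\<close> term.\<close>
    then have "Gm b = h" using v Gm_add by simp
    then show ?thesis using green[OF _ b(1)] b(2) by (intro exI[of _ b]) simp
  qed
  moreover have "\<exists>v. \<forall>u\<in>?D. norm (ipp (Gp u) h) = norm (ipV (?A u) v + ipV u (?A v))" for h
  proof -
    obtain v where v: "v \<in> ?D" "h = Gp v" using Gp_surj by (metis UNIV_I imageE)
    then obtain a b where "v = a + b" and a: "a \<in> ?D" "Gm a = 0" and "b \<in> ?D" "Gp b = 0"
      using decomp by blast
    \<comment> \<open>Now the component in the kernel of \<open>Gm\<close> carries \<open>h\<close>,
      so the \<open>Gm\<close> term drops out instead.\<close>
    then have "Gp a = h" using v Gp_add by simp
    then show ?thesis using green[OF _ a(1)] a(2) by (intro exI[of _ a]) simp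
  qed
  ultimately show ?thesis
    using V.continuous_map_graph_topology[OF assms(3) Hm.pre_hilbert_space_axioms Gm_linear]
      V.continuous_map_graph_topology[OF assms(3) Hp.pre_hilbert_space_axioms Gp_linear]
    by blast
qed

end
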